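(* Let $G$ be a connected graph of order $n\ge 4$ with diameter $2$ and $\omega(G)\le 3$. Then $$\mu_5(G)=\begin{cases}\dfrac{1+\sqrt{33}}{2} & \text{if } C_5 \text{ or } S_4^+ \text{ is an induced subgraph of } G,\\[2mm] \dfrac{3+\sqrt{17}}{2} & \text{if neither } C_5 \text{ nor } S_4^+ \text{ is an induced subgraph of } G \text{ but } K_4-e \text{ is},\\[2mm] 4 & \text{otherwise.}\end{cases}$$
   Context: All graphs are finite, undirected, simple and connected. The distance matrix $\mathcal{D}(G)$ of a graph $G$ on vertices $1,\dots,n$ is the $n\times n$ matrix whose $(i,j)$ entry is the length of a shortest path from $i$ to $j$. A real number $\lambda$ is a Pareto eigenvalue of a real $n\times n$ matrix $A$ if there is a nonzero vector $\mathbf{x}\in\mathbb{R}^n$, $\mathbf{x}\ge 0$ (entrywise), with $A\mathbf{x}\ge\lambda\mathbf{x}$ (entrywise) and $\lambda=\frac{\mathbf{x}^TA\mathbf{x}}{\mathbf{x}^T\mathbf{x}}$. The distance Pareto eigenvalues of $G$ are the Pareto eigenvalues of $\mathcal{D}(G)$. $\mu_k(G)$ denotes the $k$-th smallest element of the set of distinct distance Pareto eigenvalues of $G$. $\omega(G)$ is the clique number of $G$. $C_5$ is the cycle on 5 vertices; $S_4^+$ is the graph obtained from the star $S_4$ on 4 vertices by adding an edge between two of its leaves; $K_4-e$ is the complete graph on 4 vertices with one edge removed. *)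

theory Defs
  imports "HOL-Analysis.Analysis" "Graph_Theory.Graph_Theory"
begin

text \<open>
  A finite simple graph is a \<^locale>\<open>pair_graph\<close>: a finite, loop-free, symmetric set of arcs
  without parallel arcs, so that an undirected edge is a pair of opposite arcs.
\<close>

definition graph_dist :: "'a pair_pre_digraph \<Rightarrow> 'a \<Rightarrow> 'a \<Rightarrow> nat" where
  "graph_dist G u v =
    (LEAST k. \<exists>p. pre_digraph.apath (with_proj G) u p v \<and> length p = k)"

definition graph_diameter :: "'a pair_pre_digraph \<Rightarrow> nat" where
  "graph_diameter G = Max {graph_dist G u v | u v. u \<in> pverts G \<and> v \<in> pverts G}"

definition clique_number :: "'a pair_pre_digraph \<Rightarrow> nat" where
  "clique_number G = Max {k. \<exists>H. subgraph H (with_proj G) \<and> complete_digraph k H}"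

definition has_induced :: "'a pair_pre_digraph \<Rightarrow> 'b pair_pre_digraph \<Rightarrow> bool" where
  "has_induced G F \<longleftrightarrow>
    (\<exists>H. induced_subgraph H (with_proj G) \<and> digraph_iso (with_proj F) H)"

definition undirected :: "'a set \<Rightarrow> 'a rel \<Rightarrow> 'a pair_pre_digraph" where
  "undirected V E = \<lparr> pverts = V, parcs = E \<union> E\<inverse> \<rparr>"

definition C5 :: "nat pair_pre_digraph" where
  "C5 = undirected {0..<5} {(i, (i + 1) mod 5) | i. i < 5}"

text \<open>The star with centre 0 and leaves 1, 2, 3, together with the edge 12.\<close>

definition S4_plus :: "nat pair_pre_digraph" where
  "S4_plus = undirected {0..<4} ({(0, 1), (0, 2), (0, 3)} \<union> {(1, 2)})"

definition K4_minus_edge :: "nat pair_pre_digraph" where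
  "K4_minus_edge = undirected {0..<4} ({(i, j). i < j \<and> j < 4} - {(2, 3)})"

definition pareto_eigenvalue :: "real ^ 'n ^ 'n \<Rightarrow> real \<Rightarrow> bool" where
  "pareto_eigenvalue A l \<longleftrightarrow>
    (\<exists>x :: real ^ 'n. x \<noteq> 0 \<and> 0 \<le> x \<and> l *\<^sub>R x \<le> A *v x \<and> l = (x \<bullet> (A *v x)) / (x \<bullet> x))"

text \<open>The vertices index the matrix, so this is used for graphs whose vertex set is all of
  the finite type \<open>'n\<close>.\<close>

definition distance_matrix :: "'n::finite pair_pre_digraph \<Rightarrow> real ^ 'n ^ 'n" where
  "distance_matrix G = (\<chi> i j. real (graph_dist G i j))"

text \<open>
  Counting from \<open>k = 1\<close>. For \<open>k \<ge> 1\<close> the cardinality condition also forces the set of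
  elements up to \<open>x\<close> to be finite; if no such element exists the value is unspecified.
\<close>

definition kth_smallest :: "nat \<Rightarrow> real set \<Rightarrow> real" where
  "kth_smallest k S = (THE x. x \<in> S \<and> card {y \<in> S. y \<le> x} = k)"

definition mu :: "nat \<Rightarrow> 'n::finite pair_pre_digraph \<Rightarrow> real" where
  "mu k G = kth_smallest k {l. pareto_eigenvalue (distance_matrix G) l}"

end

theory Submission
  imports Defs
begin

text \<open>
  The Pareto eigenvalues of a nonnegative matrix are the eigenvalues of its principal submatrices
  that have a positive eigenvector. In diameter 2 the distance matrix has entries 1 (adjacent) and
  2 (nonadjacent) off the diagonal, so every principal submatrix of order at least 5, and every one
  of order 4 with two nonadjacent pairs, has average row sum, hence eigenvalue, at least 4. As
  \<open>K\<^sub>4\<close> is excluded, the eigenvalues below 4 come from \<open>K\<^sub>1\<close>, \<open>K\<^sub>2\<close>, \<open>K\<^sub>3\<close>, \<open>2 K\<^sub>1\<close>,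
  \<open>P\<^sub>3\<close>, \<open>K\<^sub>2 + K\<^sub>1\<close> and \<open>K\<^sub>4 - e\<close>; they are \<open>0, 1, 2, 2, 1 + sqrt 3\<close>,
  \<open>(1 + sqrt 33) / 2\<close> and \<open>(3 + sqrt 17) / 2\<close>. The values \<open>0, 1, 2, 1 + sqrt 3\<close> always occur. In
  diameter 2, an induced \<open>K\<^sub>2 + K\<^sub>1\<close> extends, through common neighbours, to an induced \<open>C\<^sub>5\<close> or
  \<open>S\<^sub>4\<^sup>+\<close>, both of which contain it. A graph with neither \<open>K\<^sub>2 + K\<^sub>1\<close> nor \<open>K\<^sub>4 - e\<close> has three
  independent vertices or an induced \<open>C\<^sub>4\<close>, and both have eigenvalue 4.
\<close>

section \<open>Pareto eigenvalues of nonnegative matrices\<close>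

text \<open>Complementarity: \<open>x \<bullet> (A *v x - l *\<^sub>R x) = 0\<close> is a sum of
  nonnegative terms, so the eigenvalue equation is exact on the support \<open>S\<close> of
  \<open>x\<close>. Conversely, \<open>f\<close> is extended by zero, and nonnegativity of
  \<open>A\<close> supplies the inequality outside \<open>S\<close>.\<close>

lemma pareto_eigenvalue_iff:
  fixes A :: "real ^ 'n ^ 'n::finite"
  assumes nonneg: "\<And>i j. A $ i $ j \<ge> 0"
  shows "pareto_eigenvalue A l \<longleftrightarrow>
    (\<exists>S f. S \<noteq> {} \<and> (\<forall>i\<in>S. f i > 0) \<and> (\<forall>i\<in>S. (\<Sum>j\<in>S. A $ i $ j * f j) = l * f i))"
    (is "?L \<longleftrightarrow> ?R")
proof
  assume ?L
  then obtain x :: "real ^ 'n" where x: "x \<noteq> 0" "0 \<le> x" "l *\<^sub>R x \<le> A *v x"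
    and l: "l = (x \<bullet> (A *v x)) / (x \<bullet> x)"
    unfolding pareto_eigenvalue_def by blast
  define S where "S = {i. x $ i > 0}"
  have x0: "x $ i \<ge> 0" for i using x(2) by (simp add: less_eq_vec_def)
  have ge: "(A *v x) $ i - l * x $ i \<ge> 0" for i using x(3) by (simp add: less_eq_vec_def)
  have "x \<bullet> (A *v x) = l * (x \<bullet> x)" using l x(1) by simp
  then have "(\<Sum>i\<in>UNIV. x $ i * ((A *v x) $ i - l * x $ i)) = 0"
    by (simp add: inner_vec_def right_diff_distrib sum_subtractf sum_distrib_left mult.left_commute)
  then have "\<forall>i\<in>UNIV. x $ i * ((A *v x) $ i - l * x $ i) = 0"
    by (subst (asm) sum_nonneg_eq_0_iff) (auto intro!: mult_nonneg_nonneg x0 ge)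
  then have eq: "(A *v x) $ i = l * x $ i" if "i \<in> S" for i using that by (force simp: S_def)
  have "(\<Sum>j\<in>S. A $ i $ j * x $ j) = (A *v x) $ i" for i
    unfolding matrix_vector_mult_def
    by (simp, rule sum.mono_neutral_left) (use x0 in \<open>auto simp: S_def order.order_iff_strict\<close>)
  moreover have "S \<noteq> {}" using x(1) x0 by (force simp: S_def vec_eq_iff order.order_iff_strict)
  ultimately show ?R using eq by (intro exI[of _ S] exI[of _ "\<lambda>i. x $ i"]) (auto simp: S_def)
next
  assume ?R
  then obtain S f where S: "S \<noteq> {}" "\<forall>i\<in>S. f i > 0"
    and eq: "\<forall>i\<in>S. (\<Sum>j\<in>S. A $ i $ j * f j) = l * f i" by blast
  define x :: "real ^ 'n" where "x = (\<chi> i. if i \<in> S then f i else 0)"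
  have x0: "x $ i \<ge> 0" for i using S(2) by (auto simp: x_def intro: less_imp_le)
  have Ax: "(A *v x) $ i = (\<Sum>j\<in>S. A $ i $ j * f j)" for i
    unfolding matrix_vector_mult_def x_def by (simp add: if_distrib sum.If_cases cong: if_cong)
  have Ax0: "(A *v x) $ i \<ge> 0" for i
    using x0 nonneg by (auto simp: matrix_vector_mult_def intro!: sum_nonneg)
  obtain i where "i \<in> S" using S(1) by blast
  then have "x $ i > 0" using S(2) by (simp add: x_def)
  then have "x \<noteq> 0" by auto
  moreover have "l *\<^sub>R x \<le> A *v x"
    unfolding less_eq_vec_def using Ax Ax0 eq by (auto simp: x_def)
  moreover have "x \<bullet> (A *v x) = l * (x \<bullet> x)"
    unfolding inner_vec_def sum_distrib_left
    by (rule sum.cong) (use Ax eq in \<open>auto simp: x_def\<close>)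
  ultimately show ?L
    unfolding pareto_eigenvalue_def using x0 by (intro exI[of _ x]) (auto simp: less_eq_vec_def)
qed

text \<open>
  By \<open>x / y + y / x \<ge> 2\<close>, no Perron--Frobenius theory is needed to bound an eigenvalue with a
  positive eigenvector from below by the average row sum.
\<close>

lemma sum_le_positive_eigenvalue:
  fixes d :: "'a \<Rightarrow> 'a \<Rightarrow> real"
  assumes "finite S" and d0: "\<And>i j. d i j \<ge> 0" and sym: "\<And>i j. d i j = d j i"
    and f: "\<And>i. i \<in> S \<Longrightarrow> f i > 0"
    and eq: "\<And>i. i \<in> S \<Longrightarrow> (\<Sum>j\<in>S. d i j * f j) = l * f i"
  shows "(\<Sum>i\<in>S. \<Sum>j\<in>S. d i j) \<le> l * card S"
proof -
  have row: "(\<Sum>j\<in>S. d i j * (f j / f i)) = l" if "i \<in> S" for i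
  proof -
    have "(\<Sum>j\<in>S. d i j * (f j / f i)) = (\<Sum>j\<in>S. d i j * f j) / f i"
      by (simp add: sum_divide_distrib)
    also have "\<dots> = l" using eq[OF that] f[OF that] by simp
    finally show ?thesis .
  qed
  \<comment> \<open>By symmetry of \<open>d\<close>, exchanging the summations turns the inverted
    ratios back into those of \<open>row\<close>.\<close>
  have "(\<Sum>i\<in>S. \<Sum>j\<in>S. d i j * (f i / f j)) = (\<Sum>j\<in>S. \<Sum>i\<in>S. d j i * (f i / f j))"
    by (subst sum.swap) (simp add: sym)
  then have col: "(\<Sum>i\<in>S. \<Sum>j\<in>S. d i j * (f i / f j)) = l * card S" using row by simp
  have amgm: "2 \<le> f j / f i + f i / f j" if "i \<in> S" "j \<in> S" for i j
  proof -
    have "0 \<le> (f i - f j)\<^sup>2" by simp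
    then have "2 * (f i * f j) \<le> f j * f j + f i * f i" by (simp add: power2_eq_square algebra_simps)
    then show ?thesis using f[OF that(1)] f[OF that(2)] by (simp add: field_simps)
  qed
  have "2 * (\<Sum>i\<in>S. \<Sum>j\<in>S. d i j) = (\<Sum>i\<in>S. \<Sum>j\<in>S. d i j * 2)"
    by (simp add: sum_distrib_left mult.commute)
  also have "\<dots> \<le> (\<Sum>i\<in>S. \<Sum>j\<in>S. d i j * (f j / f i + f i / f j))"
    by (intro sum_mono mult_left_mono amgm d0)
  also have "\<dots> = (\<Sum>i\<in>S. \<Sum>j\<in>S. d i j * (f j / f i)) + (\<Sum>i\<in>S. \<Sum>j\<in>S. d i j * (f i / f j))"
    by (simp add: distrib_left sum.distrib)
  also have "\<dots> = 2 * (l * card S)" using row col by simp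
  finally show ?thesis by simp
qed

section \<open>Perron eigenvalues of small distance matrices\<close>

text \<open>The product of the roots is \<open>- q < 0\<close>, so only one root is positive, the
  one with the plus sign.\<close>

lemma quadratic_root:
  fixes l p q :: real
  assumes "l * l = p * l + q" "q > 0" "l > 0"
  shows "l = (p + sqrt (p * p + 4 * q)) / 2"
proof -
  have sq: "(2 * l - p)\<^sup>2 = p * p + 4 * q" using assms(1) by (simp add: power2_eq_square algebra_simps)
  have "l * (l - p) > 0" using assms by (simp add: algebra_simps)
  then have "2 * l - p > 0" using assms(3) by (simp add: zero_less_mult_iff)
  then have "sqrt (p * p + 4 * q) = 2 * l - p" using sq by (intro real_sqrt_unique) auto
  then show ?thesis by simp
qed

text \<open>\<open>y\<close> is the weight of the centre. Subtracting the equations of the two ends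
  forces equal weights there, which leaves a quadratic in \<open>l\<close>.\<close>

lemma perron_P3:
  fixes l x y z :: real
  assumes "x > 0" "y > 0" "z > 0"
    and e: "l * x = y + 2 * z" "l * y = x + z" "l * z = 2 * x + y"
  shows "l = 1 + sqrt 3"
proof -
  have l: "l > 0" using assms by (metis add_pos_pos zero_less_mult_pos2)
  have "(l + 2) * (x - z) = 0" using e by (simp add: algebra_simps)
  then have xz: "z = x" using l by simp
  have "x * (l * l) = x * (2 * l + 2)"
    using e xz by (simp add: algebra_simps)
  then have "l * l = 2 * l + 2" using \<open>x > 0\<close> by (metis less_irrefl mult_left_cancel)
  then have "l = (2 + sqrt (2 * 2 + 4 * 2)) / 2" using quadratic_root l by simp
  moreover have "sqrt (2 * 2 + 4 * 2) = 2 * sqrt 3" using real_sqrt_mult[of 4 3] by simp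
  ultimately show ?thesis by simp
qed

text \<open>\<open>x\<close> and \<open>y\<close> are the weights of the ends of the edge, equal by
  subtraction; \<open>z\<close> is that of the isolated vertex.\<close>

lemma perron_K2_K1:
  fixes l x y z :: real
  assumes "x > 0" "y > 0" "z > 0"
    and e: "l * x = y + 2 * z" "l * y = x + 2 * z" "l * z = 2 * x + 2 * y"
  shows "l = (1 + sqrt 33) / 2"
proof -
  have l: "l > 0" using assms by (metis add_pos_pos mult_2 zero_less_mult_pos2)
  have "(l + 1) * (x - y) = 0" using e by (simp add: algebra_simps)
  then have xy: "y = x" using l by simp
  have "l * (l * x) = l * x + 2 * (l * z)" using e(1) xy by (simp add: algebra_simps)
  then have "x * (l * l) = x * (1 * l + 8)" using e(3) xy by (simp add: algebra_simps)
  then have "l * l = 1 * l + 8" using \<open>x > 0\<close> by (metis less_irrefl mult_left_cancel)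
  then show ?thesis using quadratic_root[of l 1 8] l by simp
qed

text \<open>\<open>z\<close> and \<open>w\<close> belong to the nonadjacent pair. Weights agree
  within each of the two symmetry classes, so two unknowns remain.\<close>

lemma perron_K4_minus_edge:
  fixes l x y z w :: real
  assumes "x > 0" "y > 0" "z > 0" "w > 0"
    and e: "l * x = y + z + w" "l * y = x + z + w" "l * z = x + y + 2 * w" "l * w = x + y + 2 * z"
  shows "l = (3 + sqrt 17) / 2"
proof -
  have "l * x > 0" using assms by simp
  then have l: "l > 0" using assms(1) zero_less_mult_pos2 by blast
  have "(l + 1) * (x - y) = 0" "(l + 2) * (z - w) = 0" using e by (simp_all add: algebra_simps)
  then have xy: "y = x" "w = z" using l by auto
  have "l * (l * x) = l * x + 2 * (l * z)" using e(1) xy by (simp add: algebra_simps)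
  \<comment> \<open>Here \<open>4 * z\<close>, coming from \<open>2 * (l * z)\<close>, is replaced
    by \<open>2 * (l * x - x)\<close>.\<close>
  then have "l * (l * x) = 3 * (l * x) + 2 * x" using e(1,3) xy by (simp add: algebra_simps)
  then have "x * (l * l) = x * (3 * l + 2)" by (simp add: algebra_simps)
  then have "l * l = 3 * l + 2" using \<open>x > 0\<close> by (metis less_irrefl mult_left_cancel)
  then show ?thesis using quadratic_root[of l 3 2] l by simp
qed

lemma value_order:
  "2 < 1 + sqrt 3" "1 + sqrt 3 < (1 + sqrt 33) / 2" "(1 + sqrt 33) / 2 < (3 + sqrt 17) / 2"
  "(3 + sqrt 17) / 2 < 4"
proof -
  have s3: "1 < sqrt 3" "sqrt 3 < 2" by (auto intro: real_less_rsqrt real_less_lsqrt)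
  have s33: "5 < sqrt 33" "sqrt 33 < 6" by (auto intro: real_less_rsqrt real_less_lsqrt)
  have s17: "4 < sqrt 17" "sqrt 17 < 5" by (auto intro: real_less_rsqrt real_less_lsqrt)
  \<comment> \<open>The integer bounds on the roots place 3 and 7/2 between the three irrational
    values.\<close>
  show "2 < 1 + sqrt 3" "1 + sqrt 3 < (1 + sqrt 33) / 2" "(1 + sqrt 33) / 2 < (3 + sqrt 17) / 2"
    "(3 + sqrt 17) / 2 < 4" using s3 s33 s17 by (simp_all add: field_simps)
qed

section \<open>The spectrum of a graph of diameter two\<close>

text \<open>In diameter two this is the graph distance (\<open>graph_dist_eq\<close>), so the
  spectral part can work with the adjacency relation alone.\<close>

definition dist2 :: "('a \<Rightarrow> 'a \<Rightarrow> bool) \<Rightarrow> 'a \<Rightarrow> 'a \<Rightarrow> real" where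
  "dist2 E i j = (if i = j then 0 else if E i j then 1 else 2)"

lemma dist2_same [simp]: "dist2 E i i = 0"
  by (simp add: dist2_def)

text \<open>The combinatorial content of the hypotheses: diameter at most two, diameter at least
  two, clique number at most three, order at least four.\<close>

locale diameter_two =
  fixes E :: "'n::finite \<Rightarrow> 'n \<Rightarrow> bool"
  assumes sym: "E u v \<Longrightarrow> E v u"
    and irrefl: "\<not> E u u"
    and common_neighbour: "u \<noteq> v \<Longrightarrow> \<not> E u v \<Longrightarrow> \<exists>w. E u w \<and> E w v"
    and nonadjacent: "\<exists>u v. u \<noteq> v \<and> \<not> E u v"
    and no_K4: "card S = 4 \<Longrightarrow> \<exists>u\<in>S. \<exists>v\<in>S. u \<noteq> v \<and> \<not> E u v"
    and order_ge_4: "CARD('n) \<ge> 4"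
begin

definition spectrum :: "real set" where
  "spectrum = {l. pareto_eigenvalue (\<chi> i j. dist2 E i j) l}"

definition has_K2_K1 :: bool where
  "has_K2_K1 \<longleftrightarrow> (\<exists>a b c. E a b \<and> c \<noteq> a \<and> c \<noteq> b \<and> \<not> E a c \<and> \<not> E b c)"

definition has_K4_e :: bool where
  "has_K4_e \<longleftrightarrow>
    (\<exists>a b c d. distinct [a, b, c, d] \<and> E a b \<and> E a c \<and> E a d \<and> E b c \<and> E b d \<and> \<not> E c d)"

lemma sym_iff: "E u v \<longleftrightarrow> E v u"
  using sym by blast

lemma dist2_sym: "dist2 E i j = dist2 E j i"
  using sym_iff by (auto simp: dist2_def)

lemma dist2_nonneg: "dist2 E i j \<ge> 0"
  by (simp add: dist2_def)

lemma dist2_ge_1: "i \<noteq> j \<Longrightarrow> dist2 E i j \<ge> 1"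
  by (simp add: dist2_def)

lemma spectrum_iff:
  "l \<in> spectrum \<longleftrightarrow>
    (\<exists>S f. S \<noteq> {} \<and> (\<forall>i\<in>S. f i > 0) \<and> (\<forall>i\<in>S. (\<Sum>j\<in>S. dist2 E i j * f j) = l * f i))"
  unfolding spectrum_def using pareto_eigenvalue_iff[of "\<chi> i j. dist2 E i j" l]
  by (simp add: dist2_nonneg)

lemma spectrumI:
  assumes "S \<noteq> {}" "\<And>i. i \<in> S \<Longrightarrow> f i > 0"
    "\<And>i. i \<in> S \<Longrightarrow> (\<Sum>j\<in>S. dist2 E i j * f j) = l * f i"
  shows "l \<in> spectrum"
  unfolding spectrum_iff using assms by (intro exI[of _ S] exI[of _ f]) blast

section \<open>Eigenvalues with a positive eigenvector, by order of the principal submatrix\<close>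

lemma eigenvalue_card_2:
  assumes "card S = 2" and f: "\<And>i. i \<in> S \<Longrightarrow> f i > 0"
    and eq: "\<And>i. i \<in> S \<Longrightarrow> (\<Sum>j\<in>S. dist2 E i j * f j) = l * f i"
  shows "l = 1 \<or> l = 2"
proof -
  obtain a b where S: "S = {a, b}" "a \<noteq> b" using assms(1) by (auto simp: card_2_iff)
  define d where "d = dist2 E a b"
  have d: "d = 1 \<or> d = 2" using S(2) by (auto simp: d_def dist2_def)
  have e: "d * f b = l * f a" "d * f a = l * f b"
    using eq[of a] eq[of b] S dist2_sym[of b a] by (simp_all add: d_def)
  have p: "f a > 0" "f b > 0" using f S by auto
  have "(l + d) * (f a - f b) = 0" using e by (simp add: algebra_simps)
  moreover have "l > 0" using e(1) p d by (metis mult_pos_pos zero_less_mult_pos2 zero_less_numeral zero_less_one)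
  ultimately have "f a = f b" using d by auto
  then show ?thesis using e p d by auto
qed

text \<open>The eight labelled graphs on three vertices fall into four types. The triangle and the
  empty graph have constant row sums 2 and 4; the others are \<open>P3\<close> or
  \<open>K2 + K1\<close> up to relabelling.\<close>

lemma eigenvalue_card_3:
  assumes "card S = 3" and f: "\<And>i. i \<in> S \<Longrightarrow> f i > 0"
    and eq: "\<And>i. i \<in> S \<Longrightarrow> (\<Sum>j\<in>S. dist2 E i j * f j) = l * f i"
  shows "l = 2 \<or> l = 1 + sqrt 3 \<or> (l = (1 + sqrt 33) / 2 \<and> has_K2_K1) \<or> l = 4"
proof -
  obtain a b c where S: "S = {a, b, c}" "a \<noteq> b" "a \<noteq> c" "b \<noteq> c"
    using assms(1) by (auto simp: card_3_iff)
  have p: "f a > 0" "f b > 0" "f c > 0" using f S by auto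
  have e: "l * f a = dist2 E a b * f b + dist2 E a c * f c"
    "l * f b = dist2 E a b * f a + dist2 E b c * f c"
    "l * f c = dist2 E a c * f a + dist2 E b c * f b"
    using eq[of a] eq[of b] eq[of c] S dist2_sym[of b a] dist2_sym[of c a] dist2_sym[of c b]
    by (simp_all add: insert_commute)
  have s: "f a + f b + f c > 0" using p by simp
  have K: "has_K2_K1" if "E x y" "\<not> E x z" "\<not> E y z" "z \<noteq> x" "z \<noteq> y" for x y z
    using that unfolding has_K2_K1_def by blast
  note D = dist2_def
  consider (K3) "E a b" "E a c" "E b c"
    | (P1) "\<not> E a b" "E a c" "E b c" | (P2) "E a b" "\<not> E a c" "E b c" | (P3) "E a b" "E a c" "\<not> E b c"
    | (K1) "E a b" "\<not> E a c" "\<not> E b c" | (K2) "\<not> E a b" "E a c" "\<not> E b c"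
    | (K3') "\<not> E a b" "\<not> E a c" "E b c" | (N) "\<not> E a b" "\<not> E a c" "\<not> E b c" by blast
  then show ?thesis
  proof cases
    case K3
    \<comment> \<open>The three eigenvalue equations are added.\<close>
    then have "(l - 2) * (f a + f b + f c) = 0" using e S by (simp add: D algebra_simps)
    then show ?thesis using s by simp
  next
    case P1
    then show ?thesis using perron_P3[of "f a" "f c" "f b" l] e p S by (simp add: D algebra_simps)
  next
    case P2
    then show ?thesis using perron_P3[of "f a" "f b" "f c" l] e p S by (simp add: D algebra_simps)
  next
    case P3
    then show ?thesis using perron_P3[of "f b" "f a" "f c" l] e p S by (simp add: D algebra_simps)
  next
    case K1
    then have "has_K2_K1" using K[of a b c] S sym_iff by metis
    moreover have "l = (1 + sqrt 33) / 2"
      by (rule perron_K2_K1[of "f a" "f b" "f c"]) (use K1 e p S in \<open>simp_all add: D algebra_simps\<close>)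
    ultimately show ?thesis by simp
  next
    case K2
    then have "has_K2_K1" using K[of a c b] S sym_iff by metis
    moreover have "l = (1 + sqrt 33) / 2"
      by (rule perron_K2_K1[of "f a" "f c" "f b"]) (use K2 e p S in \<open>simp_all add: D algebra_simps\<close>)
    ultimately show ?thesis by simp
  next
    case K3'
    then have "has_K2_K1" using K[of b c a] S sym_iff by metis
    moreover have "l = (1 + sqrt 33) / 2"
      by (rule perron_K2_K1[of "f b" "f c" "f a"]) (use K3' e p S in \<open>simp_all add: D algebra_simps\<close>)
    ultimately show ?thesis by simp
  next
    case N
    then have "(l - 4) * (f a + f b + f c) = 0" using e S by (simp add: D algebra_simps)
    then show ?thesis using s by simp
  qed
qed

text \<open>Some pair \<open>u\<close>, \<open>v\<close> is nonadjacent. If it is the only one,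
  \<open>S\<close> induces \<open>K4 - e\<close>; a second one raises the average row sum to at
  least 4.\<close>

lemma eigenvalue_card_4:
  assumes "card S = 4" and f: "\<And>i. i \<in> S \<Longrightarrow> f i > 0"
    and eq: "\<And>i. i \<in> S \<Longrightarrow> (\<Sum>j\<in>S. dist2 E i j * f j) = l * f i"
  shows "(l = (3 + sqrt 17) / 2 \<and> has_K4_e) \<or> l \<ge> 4"
proof -
  obtain u v where uv: "u \<in> S" "v \<in> S" "u \<noteq> v" "\<not> E u v" using no_K4[OF assms(1)] by blast
  have "card (S - {u, v}) = 2" using assms(1) uv by (simp add: card_Diff_subset)
  then obtain w z where "S - {u, v} = {w, z}" and wz: "w \<noteq> z" by (auto simp: card_2_iff)
  then have S: "S = {u, v, w, z}" and n: "w \<noteq> u" "w \<noteq> v" "z \<noteq> u" "z \<noteq> v" using uv by auto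
  note n = n n[symmetric] wz wz[symmetric] uv(3) uv(3)[symmetric]
  show ?thesis
  proof (cases "E u w \<and> E u z \<and> E v w \<and> E v z \<and> E w z")
    case True
    then have a: "E u w" "E u z" "E v w" "E v z" "E w z" "E w u" "E z u" "E w v" "E z v" "E z w"
      "\<not> E v u"
      using uv(4) sym_iff by blast+
    have e: "l * f w = f z + f u + f v" "l * f z = f w + f u + f v"
      "l * f u = f w + f z + 2 * f v" "l * f v = f w + f z + 2 * f u"
      using eq[of u] eq[of v] eq[of w] eq[of z] S n a uv(4) by (simp_all add: dist2_def algebra_simps)
    have "has_K4_e"
      unfolding has_K4_e_def by (intro exI[of _ w] exI[of _ z] exI[of _ u] exI[of _ v]) (use a n uv(4) in simp)
    then show ?thesis using perron_K4_minus_edge[OF _ _ _ _ e] f S by auto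
  next
    case False
    \<comment> \<open>One of these five distances is 2, the others are at least 1. Together with
      \<open>dist2 E u v = 2\<close> the matrix entries sum to at least 16.\<close>
    then have "dist2 E u w + dist2 E u z + dist2 E v w + dist2 E v z + dist2 E w z \<ge> 6"
      using n by (auto simp: dist2_def)
    moreover have "dist2 E u v = 2" using uv by (simp add: dist2_def)
    moreover have "(\<Sum>i\<in>S. \<Sum>j\<in>S. dist2 E i j) = 2 * (dist2 E u v + (dist2 E u w + dist2 E u z +
        dist2 E v w + dist2 E v z + dist2 E w z))"
      using S n dist2_sym[of v u] dist2_sym[of w u] dist2_sym[of w v] dist2_sym[of z u]
        dist2_sym[of z v] dist2_sym[of z w] by simp
    moreover have "(\<Sum>i\<in>S. \<Sum>j\<in>S. dist2 E i j) \<le> l * card S"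
      using f eq by (intro sum_le_positive_eigenvalue[where f = f]) (auto simp: dist2_nonneg dist2_sym)
    ultimately show ?thesis using assms(1) by simp
  qed
qed

text \<open>Every row has at least four off-diagonal entries, each at least 1, so the average row
  sum is at least 4.\<close>

lemma eigenvalue_card_ge_5:
  assumes "card S \<ge> 5" and f: "\<And>i. i \<in> S \<Longrightarrow> f i > 0"
    and eq: "\<And>i. i \<in> S \<Longrightarrow> (\<Sum>j\<in>S. dist2 E i j * f j) = l * f i"
  shows "l \<ge> 4"
proof -
  have row: "4 \<le> (\<Sum>j\<in>S. dist2 E i j)" if "i \<in> S" for i
  proof -
    have "4 \<le> real (card (S - {i}))" using assms(1) that by simp
    also have "\<dots> = (\<Sum>j\<in>S - {i}. 1)" by simp
    also have "\<dots> \<le> (\<Sum>j\<in>S - {i}. dist2 E i j)" by (intro sum_mono dist2_ge_1) auto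
    also have "\<dots> = (\<Sum>j\<in>S. dist2 E i j)" using that by (simp add: sum.remove)
    finally show ?thesis .
  qed
  have "card S * 4 \<le> (\<Sum>i\<in>S. \<Sum>j\<in>S. dist2 E i j)" using sum_bounded_below[of S 4, OF row] by simp
  also have "\<dots> \<le> l * card S"
    using f eq by (intro sum_le_positive_eigenvalue[where f = f]) (auto simp: dist2_nonneg dist2_sym)
  finally show ?thesis using assms(1) by (simp add: mult.commute[of _ 4])
qed

lemma spectrum_cases:
  assumes "l \<in> spectrum"
  shows "l \<in> {0, 1, 2, 1 + sqrt 3} \<or> (l = (1 + sqrt 33) / 2 \<and> has_K2_K1) \<or>
    (l = (3 + sqrt 17) / 2 \<and> has_K4_e) \<or> l \<ge> 4"
proof -
  obtain S f where S: "S \<noteq> {}" and f: "\<And>i. i \<in> S \<Longrightarrow> f i > 0"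
    and eq: "\<And>i. i \<in> S \<Longrightarrow> (\<Sum>j\<in>S. dist2 E i j * f j) = l * f i"
    using assms unfolding spectrum_iff by blast
  have "card S \<noteq> 0" using S by simp
  then consider "card S = 1" | "card S = 2" | "card S = 3" | "card S = 4" | "card S \<ge> 5" by linarith
  then show ?thesis
  proof cases
    case 1
    then obtain a where "S = {a}" by (auto simp: card_1_singleton_iff)
    then show ?thesis using f[of a] eq[of a] by simp
  next
    case 2 then show ?thesis using eigenvalue_card_2[OF _ f eq] by auto
  next
    case 3 then show ?thesis using eigenvalue_card_3[OF _ f eq] by auto
  next
    case 4 then show ?thesis using eigenvalue_card_4[OF _ f eq] by auto
  next
    case 5 then show ?thesis using eigenvalue_card_ge_5[OF _ f eq] by auto
  qed
qed

section \<open>Eigenvalues that occur\<close>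

lemma small_in_spectrum: "{0, 1, 2, 1 + sqrt 3} \<subseteq> spectrum"
proof -
  obtain u v where uv: "u \<noteq> v" "\<not> E u v" using nonadjacent by blast
  then obtain w where w: "E u w" "E w v" using common_neighbour by blast
  have n: "u \<noteq> w" "w \<noteq> v" "w \<noteq> u" "v \<noteq> w" "v \<noteq> u" "E w u" "E v w" "\<not> E v u"
    using uv w irrefl sym_iff by metis+
  have "0 \<in> spectrum" by (rule spectrumI[of "{u}" "\<lambda>_. 1"]) auto
  moreover have "1 \<in> spectrum"
    by (rule spectrumI[of "{u, w}" "\<lambda>_. 1"]) (use n w in \<open>auto simp: dist2_def\<close>)
  moreover have "2 \<in> spectrum"
    by (rule spectrumI[of "{u, v}" "\<lambda>_. 1"]) (use n uv in \<open>auto simp: dist2_def\<close>)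
  moreover have "1 + sqrt 3 \<in> spectrum"
    \<comment> \<open>With weight 1 at both ends, the end equation gives the centre the weight
      \<open>l - 2\<close>.\<close>
    by (rule spectrumI[of "{u, w, v}" "\<lambda>i. if i = w then sqrt 3 - 1 else 1"])
      (use n uv w value_order(1) in \<open>auto simp: dist2_def algebra_simps\<close>)
  ultimately show ?thesis by simp
qed

lemma K2_K1_in_spectrum:
  assumes has_K2_K1
  shows "(1 + sqrt 33) / 2 \<in> spectrum"
proof -
  obtain a b c where c: "E a b" "c \<noteq> a" "c \<noteq> b" "\<not> E a c" "\<not> E b c"
    using assms unfolding has_K2_K1_def by blast
  then have n: "a \<noteq> b" "b \<noteq> a" "a \<noteq> c" "b \<noteq> c" "E b a" "\<not> E c a" "\<not> E c b"
    using irrefl sym by blast+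
  have "sqrt 33 > 1" by (simp add: real_less_rsqrt)
  then show ?thesis
    \<comment> \<open>With weight 1 on the edge, \<open>l = 1 + 2 * z\<close> gives the isolated
      vertex the weight \<open>z = (l - 1) / 2\<close>.\<close>
    by (intro spectrumI[of "{a, b, c}" "\<lambda>i. if i = c then (sqrt 33 - 1) / 4 else 1"])
      (use n c in \<open>auto simp: dist2_def field_simps\<close>)
qed

lemma K4_e_in_spectrum:
  assumes has_K4_e
  shows "(3 + sqrt 17) / 2 \<in> spectrum"
proof -
  obtain a b c d where d: "distinct [a, b, c, d]" "E a b" "E a c" "E a d" "E b c" "E b d" "\<not> E c d"
    using assms unfolding has_K4_e_def by blast
  then have n: "E b a" "E c a" "E d a" "E c b" "E d b" "\<not> E d c" using sym_iff by metis+
  have "1 + sqrt 17 > 0" by (simp add: add_pos_pos)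
  then show ?thesis
    \<comment> \<open>With weight 1 at \<open>a\<close> and \<open>b\<close>, again
      \<open>l = 1 + 2 * z\<close>, where \<open>z\<close> is the weight of \<open>c\<close> and
      \<open>d\<close>.\<close>
    by (intro spectrumI[of "{a, b, c, d}" "\<lambda>i. if i = c \<or> i = d then (sqrt 17 + 1) / 4 else 1"])
      (use n d in \<open>auto simp: dist2_def field_simps\<close>)
qed

text \<open>Take \<open>u\<close>, \<open>v\<close> nonadjacent and two further vertices. Without
  \<open>K2 + K1\<close>, a vertex missing one of \<open>u\<close>, \<open>v\<close> misses both,
  which gives an independent triple. If both further vertices are adjacent to \<open>u\<close> and
  \<open>v\<close>, excluding \<open>K4 - e\<close> makes them nonadjacent, which gives an induced
  \<open>C4\<close>. All row sums are 4 in either case.\<close>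

lemma four_in_spectrum:
  assumes "\<not> has_K2_K1" "\<not> has_K4_e"
  shows "4 \<in> spectrum"
proof -
  obtain u v where uv: "u \<noteq> v" "\<not> E u v" using nonadjacent by blast
  have proper: "S \<noteq> UNIV" if "card S \<le> 3" for S :: "'n set"
    using order_ge_4 that by auto
  have "{u, v} \<noteq> UNIV" "{u, v, w} \<noteq> UNIV" for w
    by (rule proper, simp add: card_insert_if)+
  then obtain w z where w: "w \<noteq> u" "w \<noteq> v" and z: "z \<noteq> u" "z \<noteq> v" "z \<noteq> w" by blast
  have 3: "4 \<in> spectrum" if "x \<noteq> u" "x \<noteq> v" "\<not> (E u x \<and> E v x)" for x
  proof -
    have "\<not> E u x" "\<not> E v x"
      using assms(1) that uv sym_iff unfolding has_K2_K1_def by metis+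
    then have "\<not> E x u" "\<not> E x v" "\<not> E v u" using uv sym_iff by blast+
    then show ?thesis
      by (intro spectrumI[of "{u, v, x}" "\<lambda>_. 1"])
        (use that uv \<open>\<not> E u x\<close> \<open>\<not> E v x\<close> in \<open>auto simp: dist2_def\<close>)
  qed
  show ?thesis
  proof (cases "E u w \<and> E v w \<and> E u z \<and> E v z")
    case False
    then show ?thesis using 3[of w] 3[of z] w z by blast
  next
    case True
    then have n: "E w u" "E w v" "E z u" "E z v" "\<not> E v u" using uv sym_iff by blast+
    have "\<not> E w z"
    proof
      assume "E w z"
      then have has_K4_e
        unfolding has_K4_e_def
        by (intro exI[of _ w] exI[of _ z] exI[of _ u] exI[of _ v]) (use n uv w z in auto)
      with assms(2) show False by simp
    qed
    moreover from this have "\<not> E z w" using sym_iff by blast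
    ultimately show ?thesis
      by (intro spectrumI[of "{u, v, w, z}" "\<lambda>_. 1"]) (use True n uv w z in \<open>auto simp: dist2_def\<close>)
  qed
qed

text \<open>Let \<open>d\<close> be a common neighbour of \<open>a\<close>, \<open>c\<close> and
  \<open>e\<close> one of \<open>b\<close>, \<open>c\<close>. An edge \<open>d b\<close>,
  \<open>e a\<close> or \<open>d e\<close> closes a triangle with a pendant edge; with none of them,
  \<open>a b e c d\<close> is an induced 5-cycle.\<close>

lemma K2_K1_cases:
  assumes has_K2_K1
  obtains
    (C5) a b c d e where "distinct [a, b, c, d, e]" "E a b" "E b c" "E c d" "E d e" "E e a"
      "\<not> E a c" "\<not> E a d" "\<not> E b d" "\<not> E b e" "\<not> E c e"
  | (paw) a b c d where "distinct [a, b, c, d]" "E a b" "E a c" "E a d" "E b c" "\<not> E b d" "\<not> E c d"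
proof -
  obtain a b c where c: "E a b" "c \<noteq> a" "c \<noteq> b" "\<not> E a c" "\<not> E b c"
    using assms unfolding has_K2_K1_def by blast
  obtain d where d: "E a d" "E d c" using common_neighbour c by metis
  obtain e where e: "E b e" "E e c" using common_neighbour c by metis
  have n: "E b a" "E d a" "E c d" "E e b" "E c e" "\<not> E c a" "\<not> E c b" "a \<noteq> b" "a \<noteq> d" "d \<noteq> c"
    "b \<noteq> e" "e \<noteq> c" "d \<noteq> b" "e \<noteq> a"
    using c d e irrefl sym_iff by metis+
  consider "E d b" | "E e a" | "\<not> E d b" "\<not> E e a" "d = e" | "\<not> E d b" "\<not> E e a" "d \<noteq> e" "E d e"
    | "\<not> E d b" "\<not> E e a" "d \<noteq> e" "\<not> E d e" by blast
  then show thesis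
  proof cases
    case 1 then show thesis by (intro paw[of d a b c]) (use c d n in auto)
  next
    case 2 then show thesis by (intro paw[of e b a c]) (use c e n in auto)
  next
    \<comment> \<open>Impossible: \<open>d = e\<close> would be adjacent to
      \<open>b\<close>.\<close>
    case 3 then show thesis using d e sym_iff by metis
  next
    case 4
    then have "\<not> E a e" using sym_iff by metis
    with 4 show thesis by (intro paw[of d e c a]) (use c d e n in auto)
  next
    case 5
    then have "\<not> E a e" "\<not> E b d" "\<not> E e d" using sym_iff by metis+
    with 5 show thesis by (intro C5[of a b e c d]) (use c d e n in auto)
  qed
qed

end

section \<open>The fifth smallest eigenvalue\<close>

lemma kth_smallest_eqI:
  assumes "x \<in> S" "card {y \<in> S. y \<le> x} = k" "k > 0"
  shows "kth_smallest k S = x"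
proof -
  have less: False if "a \<in> S" "b \<in> S" "a < b" "card {y \<in> S. y \<le> a} = k" "card {y \<in> S. y \<le> b} = k" for a b
  proof -
    have "b \<in> {y \<in> S. y \<le> b}" "b \<notin> {y \<in> S. y \<le> a}" using that(2,3) by auto
    then have "{y \<in> S. y \<le> a} \<subset> {y \<in> S. y \<le> b}" using that(3) by fastforce
    \<comment> \<open>An infinite set has \<open>card\<close> 0, so \<open>k > 0\<close> forces
      finiteness.\<close>
    moreover have "finite {y \<in> S. y \<le> b}" using that(5) assms(3) card_ge_0_finite by metis
    ultimately show False using psubset_card_mono that(4,5) by (metis less_irrefl)
  qed
  show ?thesis
    unfolding kth_smallest_def
  proof (rule the_equality)
    show "x \<in> S \<and> card {y \<in> S. y \<le> x} = k" using assms by simp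
    show "z = x" if "z \<in> S \<and> card {y \<in> S. y \<le> z} = k" for z
      using less[of z x] less[of x z] that assms by (cases z x rule: linorder_cases) auto
  qed
qed

context diameter_two
begin

text \<open>Below the claimed value only the four values of \<open>small_in_spectrum\<close> occur.
  The case order follows the size of the values: a larger one counts only when the patterns of the
  smaller ones are absent.\<close>

lemma fifth_smallest_spectrum:
  "kth_smallest 5 spectrum =
    (if has_K2_K1 then (1 + sqrt 33) / 2 else if has_K4_e then (3 + sqrt 17) / 2 else 4)"
  (is "_ = ?m")
proof (rule kth_smallest_eqI)
  show m: "?m \<in> spectrum"
    using K2_K1_in_spectrum K4_e_in_spectrum four_in_spectrum by simp
  obtain m where m_def: "m = ?m" by blast
  have gt: "1 + sqrt 3 < m" using value_order by (auto simp: m_def)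
  have "l \<in> {0, 1, 2, 1 + sqrt 3} \<or> m \<le> l" if "l \<in> spectrum" for l
    using spectrum_cases[OF that] value_order by (auto simp: m_def split: if_splits)
  moreover have "0 \<le> m" "1 \<le> m" "2 \<le> m" using gt value_order(1) by linarith+
  then have "{0, 1, 2, 1 + sqrt 3, m} \<subseteq> spectrum \<inter> {..m}"
    using m gt small_in_spectrum unfolding m_def[symmetric] by simp
  ultimately have "{y \<in> spectrum. y \<le> m} = {0, 1, 2, 1 + sqrt 3, m}" by fastforce
  moreover have "distinct [0, 1, 2, 1 + sqrt 3, m]"
  proof -
    have "0 \<noteq> m" "1 \<noteq> m" "2 \<noteq> m" "1 + sqrt 3 \<noteq> m" "0 \<noteq> 1 + sqrt 3" "2 \<noteq> 1 + sqrt 3"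
      using gt value_order(1) by linarith+
    then show ?thesis by simp
  qed
  from distinct_card[OF this] have "card {0, 1, 2, 1 + sqrt 3, m} = 5" by simp
  ultimately show "card {y \<in> spectrum. y \<le> ?m} = 5" unfolding m_def[symmetric] by simp
qed simp

end

section \<open>Induced subgraphs and distances\<close>

text \<open>The library isomorphism acts on vertices, arcs and incidence maps separately. Since an
  arc of a pair graph is the pair of its ends, the vertex map determines the rest.\<close>

lemma has_induced_iff:
  assumes G: "pair_wf_digraph G" and F: "pair_wf_digraph F"
  shows "has_induced G F \<longleftrightarrow>
    (\<exists>f. inj_on f (pverts F) \<and> f ` pverts F \<subseteq> pverts G \<and>
      (\<forall>u\<in>pverts F. \<forall>v\<in>pverts F. (u, v) \<in> parcs F \<longleftrightarrow> (f u, f v) \<in> parcs G))"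
    (is "?L \<longleftrightarrow> ?R")
proof
  interpret F: pair_wf_digraph F by fact
  assume ?L
  then obtain h where ind: "induced_subgraph (app_iso h (with_proj F)) (with_proj G)"
    and iso: "pre_digraph.digraph_isomorphism (with_proj F) h"
    unfolding has_induced_def digraph_iso_def by blast
  let ?f = "iso_verts h"
  \<comment> \<open>A subgraph shares its incidence maps with the host graph, here the
    projections.\<close>
  have ht: "iso_head h = snd" "iso_tail h = fst"
    using ind by (auto simp: induced_subgraph_def subgraph_def compatible_def)
  have arcs: "iso_arcs h ` parcs F = {e \<in> parcs G. fst e \<in> ?f ` pverts F \<and> snd e \<in> ?f ` pverts F}"
    using ind by (simp add: induced_subgraph_def)
  have arc: "iso_arcs h e = (?f (fst e), ?f (snd e))" if "e \<in> parcs F" for e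
    using iso that by (simp add: pre_digraph.digraph_isomorphism_def ht prod_eq_iff)
  have inj: "inj_on ?f (pverts F)" using iso by (simp add: pre_digraph.digraph_isomorphism_def)
  have "(u, v) \<in> parcs F \<longleftrightarrow> (?f u, ?f v) \<in> parcs G" if uv: "u \<in> pverts F" "v \<in> pverts F" for u v
  proof
    assume "(u, v) \<in> parcs F"
    then show "(?f u, ?f v) \<in> parcs G" using arcs arc by force
  next
    assume "(?f u, ?f v) \<in> parcs G"
    then have "(?f u, ?f v) \<in> iso_arcs h ` parcs F" using arcs uv by auto
    then obtain e where e: "e \<in> parcs F" "iso_arcs h e = (?f u, ?f v)" by auto
    then have "fst e = u" "snd e = v"
      using arc inj_onD[OF inj] F.arc_fst_in_verts F.arc_snd_in_verts uv by auto
    then show "(u, v) \<in> parcs F" using e by auto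
  qed
  moreover have "?f ` pverts F \<subseteq> pverts G"
    using ind by (simp add: induced_subgraph_def subgraph_def)
  ultimately show ?R using inj by blast
next
  interpret F: pair_wf_digraph F by fact
  assume ?R
  then obtain f where inj: "inj_on f (pverts F)" and sub: "f ` pverts F \<subseteq> pverts G"
    and arc: "\<And>u v. u \<in> pverts F \<Longrightarrow> v \<in> pverts F \<Longrightarrow> (u, v) \<in> parcs F \<longleftrightarrow> (f u, f v) \<in> parcs G"
    by blast
  define h where "h = \<lparr>iso_verts = f, iso_arcs = map_prod f f, iso_head = snd, iso_tail = fst\<rparr>"
  have "parcs F \<subseteq> pverts F \<times> pverts F" using F.arc_fst_in_verts F.arc_snd_in_verts by force
  then have "inj_on (map_prod f f) (parcs F)"
    using map_prod_inj_on[OF inj inj] inj_on_subset by blast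
  then have iso: "pre_digraph.digraph_isomorphism (with_proj F) h"
    unfolding pre_digraph.digraph_isomorphism_def using inj F
    by (simp add: h_def wf_digraph_wp_iff)
  have arcs: "map_prod f f ` parcs F = {e \<in> parcs G. fst e \<in> f ` pverts F \<and> snd e \<in> f ` pverts F}"
    (is "?A = ?B")
  proof
    show "?A \<subseteq> ?B" using arc[THEN iffD1] F.in_arcsD1 F.in_arcsD2 by fastforce
    show "?B \<subseteq> ?A"
    proof
      fix e assume "e \<in> ?B"
      then obtain u v where "e = (f u, f v)" "u \<in> pverts F" "v \<in> pverts F" "(f u, f v) \<in> parcs G"
        by (cases e) auto
      then show "e \<in> ?A" using arc[of u v] by (intro image_eqI[of _ _ "(u, v)"]) auto
    qed
  qed
  have "wf_digraph (app_iso h (with_proj F))"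
    using wf_digraph.wf_digraphI_app_iso[OF _ iso] F by (simp add: wf_digraph_wp_iff)
  then have "induced_subgraph (app_iso h (with_proj F)) (with_proj G)"
    using sub arcs G
    by (simp add: induced_subgraph_def subgraph_def compatible_def h_def wf_digraph_wp_iff)
  then show ?L unfolding has_induced_def digraph_iso_def using iso by blast
qed

lemma pair_wf_digraph_undirected:
  assumes "E \<subseteq> V \<times> V"
  shows "pair_wf_digraph (undirected V E)"
  using assms by unfold_locales (auto simp: undirected_def)

lemma wf_examples:
  "pair_wf_digraph C5" "pair_wf_digraph S4_plus" "pair_wf_digraph K4_minus_edge"
  unfolding C5_def S4_plus_def K4_minus_edge_def
  by (rule pair_wf_digraph_undirected; auto)+

lemma pverts_examples:
  "pverts C5 = {0, 1, 2, 3, 4}" "pverts S4_plus = {0, 1, 2, 3}" "pverts K4_minus_edge = {0, 1, 2, 3}"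
  unfolding C5_def S4_plus_def K4_minus_edge_def undirected_def by (simp, force)+

text \<open>Explicit arc lists let the simplifier decide adjacency in the fixed graphs.\<close>

lemma parcs_examples:
  "parcs C5 = {(0, 1), (1, 2), (2, 3), (3, 4), (4, 0), (1, 0), (2, 1), (3, 2), (4, 3), (0, 4)}"
  "parcs S4_plus = {(0, 1), (0, 2), (0, 3), (1, 2), (1, 0), (2, 0), (3, 0), (2, 1)}"
  "parcs K4_minus_edge = {(0, 1), (0, 2), (0, 3), (1, 2), (1, 3), (1, 0), (2, 0), (3, 0), (2, 1), (3, 1)}"
proof -
  have "{(i, (i + 1) mod 5) | i. i < 5} = (\<lambda>i. (i, (i + 1) mod 5)) ` {..<5::nat}" by auto
  also have "{..<5::nat} = {0, 1, 2, 3, 4}" by auto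
  finally have "{(i, (i + 1) mod 5) | i. i < 5} = {(0, 1), (1, 2), (2, 3), (3, 4), (4, 0::nat)}" by (simp del: One_nat_def)
  then show "parcs C5 = {(0, 1), (1, 2), (2, 3), (3, 4), (4, 0), (1, 0), (2, 1), (3, 2), (4, 3), (0, 4)}"
    unfolding C5_def undirected_def by simp blast
  show "parcs S4_plus = {(0, 1), (0, 2), (0, 3), (1, 2), (1, 0), (2, 0), (3, 0), (2, 1)}"
    unfolding S4_plus_def undirected_def by simp blast
  have "{(i, j). i < j \<and> j < 4} - {(2, 3)} = {(0, 1), (0, 2), (0, 3), (1, 2), (1, 3::nat)}" by auto
  then show "parcs K4_minus_edge = {(0, 1), (0, 2), (0, 3), (1, 2), (1, 3), (1, 0), (2, 0), (3, 0), (2, 1), (3, 1)}"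
    unfolding K4_minus_edge_def undirected_def by simp blast
qed

text \<open>A connected symmetric digraph is strongly connected, so the minimum defining
  \<open>graph_dist\<close> is over a nonempty set and is attained.\<close>

lemma graph_dist_apath:
  assumes "pair_graph G" "Digraph_Component.connected (with_proj G)" "u \<in> pverts G" "v \<in> pverts G"
  shows "\<exists>p. pre_digraph.apath (with_proj G) u p v \<and> length p = graph_dist G u v"
proof -
  interpret pair_graph G by fact
  have "strongly_connected (with_proj G)"
    using symmetric_connected_imp_strongly_connected sym_arcs assms(2) by blast
  then have "u \<rightarrow>\<^sup>*\<^bsub>with_proj G\<^esub> v" using assms by (auto elim: strongly_connectedE)
  then obtain p where "apath u p v" using reachable_apath by blast
  then show ?thesis unfolding graph_dist_def
    by (intro LeastI_ex[of "\<lambda>k. \<exists>p. apath u p v \<and> length p = k"]) blast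
qed

lemma graph_dist_le: "pre_digraph.apath (with_proj G) u p v \<Longrightarrow> graph_dist G u v \<le> length p"
  unfolding graph_dist_def by (rule Least_le) blast

lemma clique_le_clique_number:
  assumes G: "pair_graph G" and S: "S \<subseteq> pverts G"
    and adj: "\<And>u v. u \<in> S \<Longrightarrow> v \<in> S \<Longrightarrow> u \<noteq> v \<Longrightarrow> (u, v) \<in> parcs G"
  shows "card S \<le> clique_number G"
proof -
  interpret pair_graph G by fact
  let ?H = "\<lparr>pverts = S, parcs = {(u, v). (u, v) \<in> S \<times> S \<and> u \<noteq> v}\<rparr>"
  have "finite S" using S pair_finite_verts finite_subset by blast
  then have "complete_digraph (card S) (with_proj ?H)" by (simp add: complete_digraph_pair_def)
  moreover have "pair_wf_digraph ?H" by unfold_locales auto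
  then have "subgraph (with_proj ?H) (with_proj G)"
    using S adj pair_wf_digraph by (auto simp: subgraph_def compatible_def wf_digraph_wp_iff)
  ultimately have "card S \<in> {k. \<exists>H. subgraph H (with_proj G) \<and> complete_digraph k H}" by blast
  \<comment> \<open>The order of the graph bounds all clique sizes, so \<open>Max\<close> is taken
    over a finite set.\<close>
  moreover have "{k. \<exists>H. subgraph H (with_proj G) \<and> complete_digraph k H} \<subseteq> {..card (pverts G)}"
    using pair_finite_verts by (auto simp: subgraph_def complete_digraph_def intro: card_mono)
  ultimately show ?thesis
    unfolding clique_number_def by (intro Max_ge) (auto intro: finite_subset)
qed

section \<open>From graphs of diameter two to the adjacency relation\<close>

context
  fixes G :: "'n::finite pair_pre_digraph" and E :: "'n \<Rightarrow> 'n \<Rightarrow> bool"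
  assumes G: "pair_graph G" and V: "pverts G = UNIV"
    and conn: "Digraph_Component.connected (with_proj G)" and diam: "graph_diameter G = 2"
  defines "E \<equiv> \<lambda>u v. (u, v) \<in> parcs G"
begin

interpretation pair_graph G by (rule G)

lemma graph_diameter_Max: "Max (range (case_prod (graph_dist G))) = 2"
proof -
  have "{graph_dist G u v | u v. u \<in> pverts G \<and> v \<in> pverts G} = range (case_prod (graph_dist G))"
    using V by auto
  then show ?thesis using diam by (simp add: graph_diameter_def)
qed

lemma graph_dist_le_2: "graph_dist G u v \<le> 2"
proof -
  have "graph_dist G u v \<in> range (case_prod (graph_dist G))" by force
  then show ?thesis unfolding graph_diameter_Max[symmetric] by (intro Max_ge) auto
qed

text \<open>Paths of length 0 and 1 exist exactly for equal and adjacent vertices; the diameter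
  bounds every other distance by 2.\<close>

lemma graph_dist_eq:
  "graph_dist G u v = (if u = v then 0 else if E u v then 1 else 2)"
proof -
  obtain p where p: "apath u p v" "length p = graph_dist G u v"
    using graph_dist_apath[OF G conn] V by blast
  consider "u = v" | "u \<noteq> v" "E u v" | "u \<noteq> v" "\<not> E u v" by blast
  then show ?thesis
  proof cases
    case 1
    have "apath u [] u" using V by (simp add: apath_Nil_iff)
    then show ?thesis using graph_dist_le[of G u "[]" u] 1 by simp
  next
    case 2
    then have "apath u [(u, v)] v" using V by (simp add: apath_simps E_def)
    moreover have "p \<noteq> []" using p(1) 2 by (auto simp: apath_Nil_iff)
    then have "length p > 0" by simp
    ultimately show ?thesis using graph_dist_le[of G u "[(u, v)]" v] 2 p(2) by simp
  next
    case 3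
    have "length p \<noteq> 0" using p(1) 3 by (auto simp: apath_Nil_iff)
    moreover have "length p \<noteq> 1"
    proof
      assume "length p = 1"
      then obtain e where "p = [e]" by (auto simp: length_Suc_conv)
      then show False using p(1) 3 by (cases e) (auto simp: apath_simps E_def)
    qed
    ultimately have "graph_dist G u v \<ge> 2" using p(2) by linarith
    then show ?thesis using graph_dist_le_2[of u v] 3 by simp
  qed
qed

text \<open>A shortest path has two arcs here, and its middle vertex is the neighbour
  sought.\<close>

lemma common_neighbour_if_not_adjacent:
  assumes "u \<noteq> v" "\<not> E u v"
  shows "\<exists>w. E u w \<and> E w v"
proof -
  obtain p where p: "apath u p v" "length p = 2"
    using graph_dist_apath[OF G conn, of u v] V graph_dist_eq[of u v] assms by auto
  then obtain e e' where "p = [e, e']" by (auto simp: length_Suc_conv numeral_2_eq_2)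
  then show ?thesis using p(1) by (cases e; cases e') (auto simp: apath_simps E_def)
qed

lemma diameter_two_adjacency:
  assumes "CARD('n) \<ge> 4" "clique_number G \<le> 3"
  shows "diameter_two E"
proof
  show "E v u" if "E u v" for u v using that arcs_symmetric by (simp add: E_def)
  show "\<not> E u u" for u using pair_no_loops by (force simp: E_def)
  show "\<exists>w. E u w \<and> E w v" if "u \<noteq> v" "\<not> E u v" for u v
    using common_neighbour_if_not_adjacent that by blast
  \<comment> \<open>The maximum is attained, so some pair is at distance exactly 2.\<close>
  have "2 \<in> range (case_prod (graph_dist G))"
    using Max_in[of "range (case_prod (graph_dist G))"] graph_diameter_Max by simp
  then obtain u v where "graph_dist G u v = 2" by auto
  then show "\<exists>u v. u \<noteq> v \<and> \<not> E u v" using graph_dist_eq[of u v] by (auto split: if_splits)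
  show "\<exists>u\<in>S. \<exists>v\<in>S. u \<noteq> v \<and> \<not> E u v" if "card S = 4" for S
    using clique_le_clique_number[OF G, of S] that assms(2) V by (force simp: E_def)
  show "CARD('n) \<ge> 4" by fact
qed

lemma mu_eq: "mu k G = kth_smallest k {l. pareto_eigenvalue (\<chi> i j. dist2 E i j) l}"
proof -
  have "distance_matrix G = (\<chi> i j. dist2 E i j)"
    by (simp add: distance_matrix_def dist2_def graph_dist_eq vec_eq_iff)
  then show ?thesis by (simp add: mu_def)
qed

lemma has_induced_K4_minus_edge_iff:
  assumes "diameter_two E"
  shows "has_induced G K4_minus_edge \<longleftrightarrow> diameter_two.has_K4_e E"
proof -
  interpret diameter_two E by fact
  note iff = has_induced_iff[OF pair_wf_digraph wf_examples(3)]
  show ?thesis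
  proof
    assume "has_induced G K4_minus_edge"
    then obtain f where inj: "inj_on f (pverts K4_minus_edge)"
      and arc: "\<And>u v. u \<in> pverts K4_minus_edge \<Longrightarrow> v \<in> pverts K4_minus_edge \<Longrightarrow>
        E (f u) (f v) \<longleftrightarrow> (u, v) \<in> parcs K4_minus_edge"
      unfolding iff E_def by metis
    have "distinct [f 0, f 1, f 2, f 3]"
      "E (f 0) (f 1)" "E (f 0) (f 2)" "E (f 0) (f 3)" "E (f 1) (f 2)" "E (f 1) (f 3)" "\<not> E (f 2) (f 3)"
      by (simp_all add: arc inj_on_eq_iff[OF inj] pverts_examples parcs_examples)
    then show has_K4_e unfolding has_K4_e_def by blast
  next
    assume has_K4_e
    then obtain a b c d where d: "distinct [a, b, c, d]" "E a b" "E a c" "E a d" "E b c" "E b d" "\<not> E c d"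
      unfolding has_K4_e_def by blast
    then have n: "E b a" "E c a" "E d a" "E c b" "E d b" "\<not> E d c" using sym_iff by metis+
    \<comment> \<open>The embedding sends vertex \<open>i\<close> to the list entry at index
      \<open>i\<close>; the entries at 2 and 3 are the nonadjacent pair.\<close>
    have "inj_on ((!) [a, b, c, d]) (pverts K4_minus_edge)"
      using d(1) by (intro inj_on_nth) (simp_all add: pverts_examples)
    moreover have "\<forall>u\<in>pverts K4_minus_edge. \<forall>v\<in>pverts K4_minus_edge.
      (u, v) \<in> parcs K4_minus_edge \<longleftrightarrow> E ([a, b, c, d] ! u) ([a, b, c, d] ! v)"
      unfolding pverts_examples parcs_examples using d n irrefl by simp
    ultimately show "has_induced G K4_minus_edge"
      unfolding iff E_def V by blast
  qed
qed

lemma has_induced_C5_or_S4_plus_iff: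
  assumes "diameter_two E"
  shows "has_induced G C5 \<or> has_induced G S4_plus \<longleftrightarrow> diameter_two.has_K2_K1 E"
proof -
  interpret diameter_two E by fact
  note iff1 = has_induced_iff[OF pair_wf_digraph wf_examples(1)]
  note iff2 = has_induced_iff[OF pair_wf_digraph wf_examples(2)]
  show ?thesis
  proof
    assume "has_induced G C5 \<or> has_induced G S4_plus"
    then show has_K2_K1
    proof
      assume "has_induced G C5"
      then obtain f where inj: "inj_on f (pverts C5)"
        and arc: "\<And>u v. u \<in> pverts C5 \<Longrightarrow> v \<in> pverts C5 \<Longrightarrow>
          E (f u) (f v) \<longleftrightarrow> (u, v) \<in> parcs C5"
        unfolding iff1 E_def by metis
      \<comment> \<open>In the 5-cycle, vertex 3 is opposite to the edge between 0 and 1.\<close>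
      have "E (f 0) (f 1)" "f 3 \<noteq> f 0" "f 3 \<noteq> f 1" "\<not> E (f 0) (f 3)" "\<not> E (f 1) (f 3)"
        by (simp_all add: arc inj_on_eq_iff[OF inj] pverts_examples parcs_examples)
      then show ?thesis unfolding has_K2_K1_def by blast
    next
      assume "has_induced G S4_plus"
      then obtain f where inj: "inj_on f (pverts S4_plus)"
        and arc: "\<And>u v. u \<in> pverts S4_plus \<Longrightarrow> v \<in> pverts S4_plus \<Longrightarrow>
          E (f u) (f v) \<longleftrightarrow> (u, v) \<in> parcs S4_plus"
        unfolding iff2 E_def by metis
      \<comment> \<open>Removing the centre 0 leaves the added edge and the leaf 3.\<close>
      have "E (f 1) (f 2)" "f 3 \<noteq> f 1" "f 3 \<noteq> f 2" "\<not> E (f 1) (f 3)" "\<not> E (f 2) (f 3)"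
        by (simp_all add: arc inj_on_eq_iff[OF inj] pverts_examples parcs_examples)
      then show ?thesis unfolding has_K2_K1_def by blast
    qed
  next
    assume has_K2_K1
    then show "has_induced G C5 \<or> has_induced G S4_plus"
    proof (cases rule: K2_K1_cases)
      case (C5 a b c d e)
      then have n: "E b a" "E c b" "E d c" "E e d" "E a e"
        "\<not> E c a" "\<not> E d a" "\<not> E d b" "\<not> E e b" "\<not> E e c"
        using sym_iff by metis+
      have "inj_on ((!) [a, b, c, d, e]) (pverts C5)"
        using C5(1) by (intro inj_on_nth) (simp_all add: pverts_examples)
      moreover have "\<forall>u\<in>pverts C5. \<forall>v\<in>pverts C5.
        (u, v) \<in> parcs C5 \<longleftrightarrow> E ([a, b, c, d, e] ! u) ([a, b, c, d, e] ! v)"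
        unfolding pverts_examples parcs_examples using C5 n irrefl by simp
      ultimately have "has_induced G C5"
        unfolding iff1 E_def V by blast
      then show ?thesis ..
    next
      case (paw a b c d)
      then have n: "E b a" "E c a" "E d a" "E c b" "\<not> E d b" "\<not> E d c" using sym_iff by metis+
      have "inj_on ((!) [a, b, c, d]) (pverts S4_plus)"
        using paw(1) by (intro inj_on_nth) (simp_all add: pverts_examples)
      moreover have "\<forall>u\<in>pverts S4_plus. \<forall>v\<in>pverts S4_plus.
        (u, v) \<in> parcs S4_plus \<longleftrightarrow> E ([a, b, c, d] ! u) ([a, b, c, d] ! v)"
        unfolding pverts_examples parcs_examples using paw n irrefl by simp
      ultimately have "has_induced G S4_plus"
        unfolding iff2 E_def V by blast
      then show ?thesis ..
    qed
  qed
qed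

end

theorem theorem4p4:
  fixes G :: "'n::finite pair_pre_digraph"
  assumes "pair_graph G"
    and "pverts G = UNIV"
    and "Digraph_Component.connected (with_proj G)"
    and "CARD('n) \<ge> 4"
    and "graph_diameter G = 2"
    and "clique_number G \<le> 3"
  shows "mu 5 G =
    (if has_induced G C5 \<or> has_induced G S4_plus then (1 + sqrt 33) / 2
     else if has_induced G K4_minus_edge then (3 + sqrt 17) / 2
     else 4)"
proof -
  let ?E = "\<lambda>u v. (u, v) \<in> parcs G"
  note G = assms(1-3,5)
  have D: "diameter_two ?E" by (rule diameter_two_adjacency[OF G assms(4,6)])
  then interpret diameter_two ?E .
  show ?thesis
    unfolding mu_eq[OF G] has_induced_C5_or_S4_plus_iff[OF G D] has_induced_K4_minus_edge_iff[OF G D]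
    by (rule fifth_smallest_spectrum[unfolded spectrum_def])
qed

end
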